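(* Let $p$ be a prime and $n\geq 1$ an integer, and let $G=\mathbb{Z}_p^n\rtimes \mathbb{Z}_{p^n-1}$ be the Frobenius group with Frobenius kernel $\mathbb{Z}_p^n$ and Frobenius complement $\mathbb{Z}_{p^n-1}$. Then the Terwilliger algebra $T(G)$ of the group association scheme of $G$ satisfies $\dim_{\mathbb{C}} T(G)=p^{2n}+p^n-1$.
   Context: Let $G$ be a finite group with identity $e$ and conjugacy classes $C_0=\{e\},C_1,\dots,C_d$. The group association scheme of $G$ has adjacency matrices $A_0,\dots,A_d$, the $|G|\times|G|$ complex matrices indexed by $G$ with $(A_i)_{xy}=1$ if $yx^{-1}\in C_i$ and $0$ otherwise. For $0\le i\le d$ let $E_i^*$ be the diagonal matrix indexed by $G$ with $(E_i^* )_{yy}=1$ if $y\in C_i$ and $0$ otherwise. The Terwilliger algebra $T(G)$ (base point the identity) is the subalgebra of $M_{|G|}(\mathbb{C})$ generated by $A_0,\dots,A_d,E_0^*,\dots,E_d^*$. That $G$ is a Frobenius group entails that the complement is nontrivial, so $p^n\neq 2$. *)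

theory Defs
  imports
    Complex_Main
    "HOL-Computational_Algebra.Primes"
    "HOL-Library.Function_Algebras"
    "HOL-Algebra.Algebra"
begin

section \<open>Frobenius groups\<close>

definition conjugate_set :: "('a, 'b) monoid_scheme \<Rightarrow> 'a \<Rightarrow> 'a set \<Rightarrow> 'a set" where
  "conjugate_set G g H = g <#\<^bsub>G\<^esub> H #>\<^bsub>G\<^esub> inv\<^bsub>G\<^esub> g"

definition internal_semidirect_product :: "('a, 'b) monoid_scheme \<Rightarrow> 'a set \<Rightarrow> 'a set \<Rightarrow> bool" where
  "internal_semidirect_product G N H \<longleftrightarrow>
     N \<lhd> G \<and> subgroup H G \<and> N \<inter> H = {\<one>\<^bsub>G\<^esub>} \<and> N <#>\<^bsub>G\<^esub> H = carrier G"

definition frobenius_complement :: "('a, 'b) monoid_scheme \<Rightarrow> 'a set \<Rightarrow> bool" where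
  "frobenius_complement G H \<longleftrightarrow>
     subgroup H G \<and> H \<noteq> {\<one>\<^bsub>G\<^esub>} \<and> H \<noteq> carrier G \<and>
     (\<forall>g \<in> carrier G - H. H \<inter> conjugate_set G g H = {\<one>\<^bsub>G\<^esub>})"

definition frobenius_kernel :: "('a, 'b) monoid_scheme \<Rightarrow> 'a set \<Rightarrow> 'a set" where
  "frobenius_kernel G H =
     insert \<one>\<^bsub>G\<^esub> (carrier G - (\<Union>g \<in> carrier G. conjugate_set G g H))"

definition cyclic_power_group :: "nat \<Rightarrow> nat \<Rightarrow> (nat \<Rightarrow> int) monoid" where
  "cyclic_power_group m n = product_group {..<n} (\<lambda>_. integer_mod_group m)"

section \<open>Complex matrices indexed by a set\<close>

text \<open>A matrix with rows and columns indexed by \<open>S\<close> is a function of two indices that vanishes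
  outside \<open>S \<times> S\<close>. Sums and the zero matrix are the pointwise ones of function spaces, but the
  product is \<open>mat_mul\<close>, not the pointwise \<open>*\<close>.\<close>

type_synonym 'a cmat = "'a \<Rightarrow> 'a \<Rightarrow> complex"

definition mat_space :: "'a set \<Rightarrow> 'a cmat set" where
  "mat_space S = {A. \<forall>x y. x \<notin> S \<or> y \<notin> S \<longrightarrow> A x y = 0}"

definition mat_one :: "'a set \<Rightarrow> 'a cmat" where
  "mat_one S = (\<lambda>x y. if x \<in> S \<and> x = y then 1 else 0)"

definition mat_mul :: "'a set \<Rightarrow> 'a cmat \<Rightarrow> 'a cmat \<Rightarrow> 'a cmat" where
  "mat_mul S A B = (\<lambda>x y. \<Sum>z\<in>S. A x z * B z y)"

definition mat_scale :: "complex \<Rightarrow> 'a cmat \<Rightarrow> 'a cmat" where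
  "mat_scale c A = (\<lambda>x y. c * A x y)"

lemma vector_space_mat_scale: "vector_space (mat_scale :: complex \<Rightarrow> 'a cmat \<Rightarrow> 'a cmat)"
  by unfold_locales (auto simp: mat_scale_def fun_eq_iff algebra_simps)

definition is_subalgebra :: "'a set \<Rightarrow> 'a cmat set \<Rightarrow> bool" where
  "is_subalgebra S T \<longleftrightarrow>
     T \<subseteq> mat_space S \<and> module.subspace mat_scale T \<and> mat_one S \<in> T \<and>
     (\<forall>A \<in> T. \<forall>B \<in> T. mat_mul S A B \<in> T)"

definition generated_subalgebra :: "'a set \<Rightarrow> 'a cmat set \<Rightarrow> 'a cmat set" where
  "generated_subalgebra S F = is_subalgebra S hull F"

text \<open>The complex dimension. As for every \<open>dim\<close>, the value on a space without a finite basis would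
  be the junk value 0; this does not occur inside \<open>mat_space S\<close> for finite \<open>S\<close>.\<close>

definition mat_dim :: "'a cmat set \<Rightarrow> nat" where
  "mat_dim T = vector_space.dim mat_scale T"

section \<open>The Terwilliger algebra of the group association scheme\<close>

definition conjugacy_class :: "('a, 'b) monoid_scheme \<Rightarrow> 'a \<Rightarrow> 'a set" where
  "conjugacy_class G x = {g \<otimes>\<^bsub>G\<^esub> x \<otimes>\<^bsub>G\<^esub> inv\<^bsub>G\<^esub> g | g. g \<in> carrier G}"

definition conjugacy_classes :: "('a, 'b) monoid_scheme \<Rightarrow> 'a set set" where
  "conjugacy_classes G = conjugacy_class G ` carrier G"

text \<open>The matrices \<open>A\<^sub>i\<close> and \<open>E\<^sub>i\<^sup>*\<close> are indexed by the class \<open>C = C\<^sub>i\<close> itself rather than by a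
  number \<open>i\<close>.\<close>

definition scheme_adjacency :: "('a, 'b) monoid_scheme \<Rightarrow> 'a set \<Rightarrow> 'a cmat" where
  "scheme_adjacency G C = (\<lambda>x y.
     if x \<in> carrier G \<and> y \<in> carrier G \<and> y \<otimes>\<^bsub>G\<^esub> inv\<^bsub>G\<^esub> x \<in> C then 1 else 0)"

definition dual_idempotent :: "('a, 'b) monoid_scheme \<Rightarrow> 'a set \<Rightarrow> 'a cmat" where
  "dual_idempotent G C = (\<lambda>x y. if x \<in> carrier G \<and> x = y \<and> y \<in> C then 1 else 0)"

definition terwilliger_algebra :: "('a, 'b) monoid_scheme \<Rightarrow> 'a cmat set" where
  "terwilliger_algebra G =
     generated_subalgebra (carrier G)
       (scheme_adjacency G ` conjugacy_classes G \<union> dual_idempotent G ` conjugacy_classes G)"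

end

theory Submission
  imports Defs "HOL-Library.Disjoint_Sets"
begin

text \<open>
  Write \<open>q = p\<^sup>n\<close> for the order of the kernel \<open>N\<close>, so that the complement \<open>H\<close> has order \<open>q - 1\<close>.

  A nontrivial element of \<open>N\<close> and a nontrivial element of \<open>H\<close> never commute. Hence \<open>H\<close> permutes the
  \<open>q - 1\<close> nontrivial elements of \<open>N\<close> freely, and therefore transitively: \<open>N - {1}\<close> is a single
  conjugacy class. For the same reason the \<open>q\<close> conjugates of \<open>h \<in> H - {1}\<close> by elements of \<open>N\<close> are
  distinct; since \<open>G/N\<close> is abelian they all lie in the coset \<open>Nh\<close>, and so they fill it. The conjugacy
  classes of \<open>G\<close> are thus \<open>{1}\<close>, \<open>N - {1}\<close> and the \<open>q - 2\<close> nontrivial cosets of \<open>N\<close>: there are \<open>q\<close> of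
  them, and only \<open>{1}\<close> is a singleton because \<open>q - 1 \<ge> 2\<close>.

  For any finite group, \<open>T(G)\<close> contains the identity matrix \<open>E\<^sub>B\<close> of every class \<open>B\<close>, and also the all-ones
  matrix \<open>J\<^sub>B\<^sub>C = E\<^sub>B J E\<^sub>C\<close> of every pair of classes, because \<open>J\<close> is the sum of all \<open>A\<^sub>i\<close>
  (\<open>block_mats_subset_subalgebra\<close>). The products of such matrices are multiples of such matrices, so
  their span is an algebra (\<open>is_subalgebra_span_block_mats\<close>). It contains each \<open>A\<^sub>i\<close>, and hence equals
  \<open>T(G)\<close>, as soon as the class of \<open>y x\<^sup>-\<^sup>1\<close> for \<open>x \<noteq> y\<close> depends only on the classes of \<open>x\<close> and \<open>y\<close>
  (\<open>terwilliger_algebra_eq_span_block_mats\<close>). In the present group this holds: the classes of \<open>x\<close> and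
  \<open>y\<close> determine their cosets of \<open>N\<close>, hence the coset of \<open>y x\<^sup>-\<^sup>1\<close>, and this coset determines the class
  of \<open>y x\<^sup>-\<^sup>1 \<noteq> 1\<close>.

  It remains to count. Among \<open>q\<^sup>2\<close> matrices \<open>J\<^sub>B\<^sub>C\<close> and \<open>q\<close> matrices \<open>E\<^sub>B\<close> the only linear relations are
  \<open>J\<^sub>B\<^sub>B = E\<^sub>B\<close> for singletons \<open>B\<close> (\<open>dim_span_block_mats\<close>), so the dimension is \<open>q\<^sup>2 + q - 1\<close>.
\<close>

interpretation mat: vector_space "mat_scale :: complex \<Rightarrow> 'a cmat \<Rightarrow> 'a cmat"
  by (rule vector_space_mat_scale)

section \<open>Indicator matrices\<close>

definition ind_mat :: "('a \<times> 'a) set \<Rightarrow> 'a cmat" where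
  "ind_mat R = (\<lambda>x y. if (x, y) \<in> R then 1 else 0)"

lemma sum_mat_apply: "(\<Sum>i\<in>I. f i) x y = (\<Sum>i\<in>I. (f i :: 'a cmat) x y)"
  by (induction I rule: infinite_finite_induct) auto

lemma ind_mat_inject: "ind_mat R = ind_mat R' \<longleftrightarrow> R = R'"
proof
  assume eq: "ind_mat R = ind_mat R'"
  have "(x, y) \<in> R \<longleftrightarrow> (x, y) \<in> R'" for x y
    using fun_cong[OF fun_cong[OF eq], of x y] by (simp add: ind_mat_def split: if_splits)
  then show "R = R'" by auto
qed simp

lemma ind_mat_disjoint_UN:
  assumes "finite I" and "disjoint_family_on R I"
  shows "ind_mat (\<Union>i\<in>I. R i) = (\<Sum>i\<in>I. ind_mat (R i))"
proof (intro ext)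
  fix x y
  show "ind_mat (\<Union>i\<in>I. R i) x y = (\<Sum>i\<in>I. ind_mat (R i)) x y"
  proof (cases "\<exists>i\<in>I. (x, y) \<in> R i")
    case True
    then obtain i where i: "i \<in> I" "(x, y) \<in> R i" by blast
    then have "(x, y) \<notin> R j" if "j \<in> I" "j \<noteq> i" for j
      using assms(2) that by (fastforce simp: disjoint_family_on_def)
    then have "(\<Sum>j\<in>I. ind_mat (R j) x y) = (\<Sum>j\<in>I. if j = i then 1 else 0)"
      using i by (intro sum.cong) (auto simp: ind_mat_def)
    then show ?thesis
      using i assms(1) by (auto simp: sum_mat_apply) (auto simp: ind_mat_def)
  next
    case False
    then show ?thesis by (auto simp: sum_mat_apply ind_mat_def)
  qed
qed

text \<open>Each member of a disjoint family has a position at which only its own indicator matrix is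
  nonzero, so the indicator matrices are linearly independent.\<close>

lemma dim_span_ind_mat_disjoint:
  assumes fin: "finite I" and dis: "disjoint_family_on R I" and ne: "\<And>i. i \<in> I \<Longrightarrow> R i \<noteq> {}"
  shows "mat.dim (mat.span ((\<lambda>i. ind_mat (R i)) ` I)) = card I"
proof -
  have uniq: "j = i" if "i \<in> I" "j \<in> I" "(x, y) \<in> R i" "(x, y) \<in> R j" for i j x y
    using dis that by (fastforce simp: disjoint_family_on_def)
  have inj: "inj_on (\<lambda>i. ind_mat (R i)) I"
  proof (rule inj_onI)
    fix i j assume ij: "i \<in> I" "j \<in> I" "ind_mat (R i) = ind_mat (R j)"
    then obtain x y where "(x, y) \<in> R i" "(x, y) \<in> R j"
      using ne[of i] by (auto simp: ind_mat_inject)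
    then show "i = j" using uniq ij by blast
  qed
  have "mat.independent ((\<lambda>i. ind_mat (R i)) ` I)"
  proof (rule mat.independent_if_scalars_zero)
    fix c M
    assume zero: "(\<Sum>A\<in>(\<lambda>i. ind_mat (R i)) ` I. mat_scale (c A) A) = 0"
      and "M \<in> (\<lambda>i. ind_mat (R i)) ` I"
    then obtain i where i: "i \<in> I" "M = ind_mat (R i)" by blast
    obtain x y where xy: "(x, y) \<in> R i" using ne[OF i(1)] by auto
    have "0 = (\<Sum>A\<in>(\<lambda>i. ind_mat (R i)) ` I. mat_scale (c A) A) x y"
      by (simp add: zero)
    also have "\<dots> = (\<Sum>j\<in>I. mat_scale (c (ind_mat (R j))) (ind_mat (R j)) x y)"
      by (simp add: sum.reindex[OF inj] sum_mat_apply)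
    also have "\<dots> = (\<Sum>j\<in>I. if j = i then c M else 0)"
    proof (rule sum.cong)
      fix j assume "j \<in> I"
      then have "(x, y) \<in> R j \<longleftrightarrow> j = i" using uniq i(1) xy by blast
      then show "mat_scale (c (ind_mat (R j))) (ind_mat (R j)) x y = (if j = i then c M else 0)"
        using i(2) by (auto simp: mat_scale_def ind_mat_def)
    qed simp
    finally show "c M = 0" using i fin by simp
  qed (use fin in simp)
  then show ?thesis
    by (simp add: mat.dim_eq_card_independent card_image[OF inj])
qed

section \<open>The algebra of a partition\<close>

text \<open>The matrices \<open>J\<^sub>B\<^sub>C\<close> and \<open>E\<^sub>B\<close> of the introduction.\<close>

definition block_mats :: "'a set set \<Rightarrow> 'a cmat set" where
  "block_mats P = (\<lambda>(B, C). ind_mat (B \<times> C)) ` (P \<times> P) \<union> (\<lambda>B. ind_mat (Id_on B)) ` P"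

lemma mat_mul_add_left: "mat_mul S (A + B) C = mat_mul S A C + mat_mul S B C"
  by (auto simp: mat_mul_def fun_eq_iff algebra_simps sum.distrib)

lemma mat_mul_add_right: "mat_mul S A (B + C) = mat_mul S A B + mat_mul S A C"
  by (auto simp: mat_mul_def fun_eq_iff algebra_simps sum.distrib)

lemma mat_mul_scale_left: "mat_mul S (mat_scale c A) B = mat_scale c (mat_mul S A B)"
  by (auto simp: mat_mul_def mat_scale_def fun_eq_iff sum_distrib_left mult_ac)

lemma mat_mul_scale_right: "mat_mul S A (mat_scale c B) = mat_scale c (mat_mul S A B)"
  by (auto simp: mat_mul_def mat_scale_def fun_eq_iff sum_distrib_left mult_ac)

lemma span_closed_mat_mul:
  assumes gen: "\<And>A B. A \<in> F \<Longrightarrow> B \<in> F \<Longrightarrow> mat_mul S A B \<in> mat.span F"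
    and A: "A \<in> mat.span F" and B: "B \<in> mat.span F"
  shows "mat_mul S A B \<in> mat.span F"
proof -
  have zero: "mat_mul S 0 B = 0" "mat_mul S A 0 = 0" for A B :: "'a cmat"
    by (auto simp: mat_mul_def fun_eq_iff)
  have right: "mat_mul S A B \<in> mat.span F" if "A \<in> F" for A
    using B by (rule mat.span_induct)
      (auto simp: mat.subspace_def zero mat_mul_add_right mat_mul_scale_right
        gen[OF that] mat.span_zero mat.span_add mat.span_scale)
  show ?thesis
    using A by (rule mat.span_induct)
      (auto simp: mat.subspace_def zero mat_mul_add_left mat_mul_scale_left
        right mat.span_zero mat.span_add mat.span_scale)
qed

lemma mat_mul_ind_mat:
  "mat_mul S (ind_mat Q) (ind_mat R) x y = of_nat (card {z \<in> S. (x, z) \<in> Q \<and> (z, y) \<in> R})"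
  if "finite S"
proof -
  have "mat_mul S (ind_mat Q) (ind_mat R) x y
      = (\<Sum>z\<in>S. if (x, z) \<in> Q \<and> (z, y) \<in> R then 1 else 0)"
    by (auto simp: mat_mul_def ind_mat_def intro!: sum.cong)
  then show ?thesis using that by (simp add: sum.If_cases Int_def)
qed

lemma is_subalgebra_span_block_mats:
  assumes S: "finite S" and P: "partition_on S P"
  shows "is_subalgebra S (mat.span (block_mats P))"
proof -
  have sub: "B \<subseteq> S" if "B \<in> P" for B using P that by (auto simp: partition_on_def)
  have disj: "B = C \<or> B \<inter> C = {}" if "B \<in> P" "C \<in> P" for B C
    using P that by (auto simp: partition_on_def disjoint_def)
  have finP: "finite P" using finite_elements[OF S P] .
  have "mat.subspace (mat_space S)"
    by (auto simp: mat.subspace_def mat_space_def mat_scale_def)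
  moreover have "block_mats P \<subseteq> mat_space S"
    using sub by (fastforce simp: block_mats_def mat_space_def ind_mat_def)
  ultimately have space: "mat.span (block_mats P) \<subseteq> mat_space S"
    by (rule mat.span_minimal[rotated])
  have disId: "disjoint_family_on Id_on P"
    using disj by (fastforce simp: disjoint_family_on_def)
  have "mat_one S = ind_mat (\<Union>B\<in>P. Id_on B)"
    using P by (auto simp: mat_one_def ind_mat_def fun_eq_iff partition_on_def)
  also have "\<dots> = (\<Sum>B\<in>P. ind_mat (Id_on B))"
    by (rule ind_mat_disjoint_UN[OF finP disId])
  also have "\<dots> \<in> mat.span (block_mats P)"
    by (intro mat.span_sum mat.span_base) (auto simp: block_mats_def)
  finally have one: "mat_one S \<in> mat.span (block_mats P)" .
  have J: "ind_mat (B \<times> C) \<in> mat.span (block_mats P)" if "B \<in> P" "C \<in> P" for B C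
    using that by (intro mat.span_base) (auto simp: block_mats_def)
  have E: "ind_mat (Id_on B) \<in> mat.span (block_mats P)" if "B \<in> P" for B
    using that by (intro mat.span_base) (auto simp: block_mats_def)
  have JJ: "mat_mul S (ind_mat (B \<times> C)) (ind_mat (C' \<times> D))
      = (if C = C' then mat_scale (of_nat (card C)) (ind_mat (B \<times> D)) else 0)"
    if "B \<in> P" "C \<in> P" "C' \<in> P" "D \<in> P" for B C C' D
  proof (intro ext)
    fix x y
    have *: "{z \<in> S. (x, z) \<in> B \<times> C \<and> (z, y) \<in> C' \<times> D}
        = (if C = C' \<and> x \<in> B \<and> y \<in> D then C else {})"
      using disj[OF that(2,3)] sub[OF that(2)] by auto
    show "mat_mul S (ind_mat (B \<times> C)) (ind_mat (C' \<times> D)) x y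
      = (if C = C' then mat_scale (of_nat (card C)) (ind_mat (B \<times> D)) else 0) x y"
      unfolding mat_mul_ind_mat[OF S] * by (simp add: mat_scale_def ind_mat_def)
  qed
  have EM: "mat_mul S (ind_mat (Id_on B)) M = (\<lambda>x y. if x \<in> B then M x y else 0)"
    if "B \<in> P" for B and M :: "'a cmat"
  proof (intro ext)
    fix x y
    have "mat_mul S (ind_mat (Id_on B)) M x y = (\<Sum>z\<in>S. if z = x then if x \<in> B then M x y else 0 else 0)"
      by (auto simp: mat_mul_def ind_mat_def Id_on_iff intro!: sum.cong sum.neutral)
    then show "mat_mul S (ind_mat (Id_on B)) M x y = (if x \<in> B then M x y else 0)"
      using S sub[OF that] by auto
  qed
  have ME: "mat_mul S M (ind_mat (Id_on B)) = (\<lambda>x y. if y \<in> B then M x y else 0)"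
    if "B \<in> P" for B and M :: "'a cmat"
  proof (intro ext)
    fix x y
    have "mat_mul S M (ind_mat (Id_on B)) x y = (\<Sum>z\<in>S. if z = y then if y \<in> B then M x y else 0 else 0)"
      by (auto simp: mat_mul_def ind_mat_def Id_on_iff intro!: sum.cong sum.neutral)
    then show "mat_mul S M (ind_mat (Id_on B)) x y = (if y \<in> B then M x y else 0)"
      using S sub[OF that] by auto
  qed
  have EJ: "mat_mul S (ind_mat (Id_on B)) (ind_mat (C \<times> D)) = (if B = C then ind_mat (C \<times> D) else 0)"
    if "B \<in> P" "C \<in> P" for B C D
    unfolding EM[OF that(1)] using disj[OF that] by (auto simp: fun_eq_iff ind_mat_def)
  have JE: "mat_mul S (ind_mat (C \<times> D)) (ind_mat (Id_on B)) = (if B = D then ind_mat (C \<times> D) else 0)"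
    if "B \<in> P" "D \<in> P" for B C D
    unfolding ME[OF that(1)] using disj[OF that] by (auto simp: fun_eq_iff ind_mat_def)
  have EE: "mat_mul S (ind_mat (Id_on B)) (ind_mat (Id_on C)) = (if B = C then ind_mat (Id_on B) else 0)"
    if "B \<in> P" "C \<in> P" for B C
    unfolding EM[OF that(1)] using disj[OF that] by (auto simp: fun_eq_iff ind_mat_def)
  have "mat_mul S A B \<in> mat.span (block_mats P)" if "A \<in> block_mats P" "B \<in> block_mats P" for A B
  proof -
    define V where "V = mat.span (block_mats P)"
    have "0 \<in> V" "\<And>c M. M \<in> V \<Longrightarrow> mat_scale c M \<in> V"
      by (auto simp: V_def mat.span_zero mat.span_scale)
    then show ?thesis
      using that J E unfolding V_def[symmetric]
      by (auto simp: block_mats_def JJ EJ JE EE)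
  qed
  then show ?thesis
    using space one span_closed_mat_mul unfolding is_subalgebra_def by blast
qed

text \<open>With the diagonal removed, the blocks can be combined with the relations \<open>Id_on B\<close> into one
  disjoint family; this is what makes a basis of the span of \<open>block_mats P\<close> visible.\<close>

lemma disjoint_blocks_off_diag:
  assumes "partition_on S P"
  shows "disjoint_family_on (\<lambda>(B, C). B \<times> C - Id) (P \<times> P)"
proof -
  have disj: "B = C \<or> B \<inter> C = {}" if "B \<in> P" "C \<in> P" for B C
    using assms that by (auto simp: partition_on_def disjoint_def)
  have "(B \<times> C - Id) \<inter> (B' \<times> C' - Id) = {}"
    if "B \<in> P" "C \<in> P" "B' \<in> P" "C' \<in> P" "(B, C) \<noteq> (B', C')" for B C B' C'
    using disj[OF that(1,3)] disj[OF that(2,4)] that(5) by auto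
  then show ?thesis by (auto simp: disjoint_family_on_def)
qed

lemma ind_mat_off_diag_in_span:
  assumes "B \<in> P" "C \<in> P" "partition_on S P"
  shows "ind_mat (B \<times> C - Id) \<in> mat.span (block_mats P)"
proof -
  have "ind_mat (B \<times> C - Id) = ind_mat (B \<times> C) - (if B = C then ind_mat (Id_on B) else 0)"
    using assms by (auto simp: ind_mat_def fun_eq_iff partition_on_def disjoint_def)
  also have "\<dots> \<in> mat.span (block_mats P)"
  proof (rule mat.span_diff)
    show "ind_mat (B \<times> C) \<in> mat.span (block_mats P)"
      using assms by (intro mat.span_base) (auto simp: block_mats_def)
    show "(if B = C then ind_mat (Id_on B) else 0) \<in> mat.span (block_mats P)"
      using assms by (auto simp: mat.span_zero block_mats_def intro: mat.span_base)
  qed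
  finally show ?thesis .
qed

text \<open>A basis consists of the indicator matrices of the diagonals \<open>Id_on B\<close> and of the blocks with
  the diagonal removed, except for the blocks \<open>B \<times> B\<close> with \<open>B\<close> a singleton, where nothing is left.
  The equation is stated additively to avoid truncated subtraction.\<close>

lemma dim_span_block_mats:
  assumes S: "finite S" and P: "partition_on S P"
  shows "mat_dim (mat.span (block_mats P)) + card {B \<in> P. is_singleton B} = card P ^ 2 + card P"
proof -
  have disj: "B = C \<or> B \<inter> C = {}" if "B \<in> P" "C \<in> P" for B C
    using P that by (auto simp: partition_on_def disjoint_def)
  have finP: "finite P" using finite_elements[OF S P] .
  have ne: "B \<noteq> {}" if "B \<in> P" for B using P that by (auto simp: partition_on_def)
  \<comment> \<open>the pairs of classes whose block has no entry off the diagonal\<close>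
  define D where "D = (\<lambda>B. (B, B)) ` {B \<in> P. is_singleton B}"
  define I where "I = Sum_Type.Plus (P \<times> P - D) P"
  define R where "R = case_sum (\<lambda>(B, C). B \<times> C - Id) (Id_on :: 'a set \<Rightarrow> _)"
  have D: "D \<subseteq> P \<times> P" by (auto simp: D_def)
  have "disjoint_family_on R I"
  proof -
    have *: "(B \<times> C - Id) \<inter> (B' \<times> C' - Id) = {}"
      if "(B, C) \<in> P \<times> P" "(B', C') \<in> P \<times> P" "(B, C) \<noteq> (B', C')" for B C B' C'
      using disjoint_family_onD[OF disjoint_blocks_off_diag[OF P] that] by simp
    have **: "(B \<times> C - Id) \<inter> Id_on B' = {}" "Id_on B' \<inter> (B \<times> C - Id) = {}" for B C B' :: "'a set"
      by auto
    have "R i \<inter> R j = {}" if "i \<in> I" "j \<in> I" "i \<noteq> j" for i j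
    proof -
      have I: "(\<exists>B C. k = Inl (B, C) \<and> B \<in> P \<and> C \<in> P) \<or> (\<exists>B. k = Inr B \<and> B \<in> P)" if "k \<in> I" for k
        using that by (auto simp: I_def)
      have ***: "Id_on B \<inter> Id_on C = {}" if "B \<in> P" "C \<in> P" "B \<noteq> C" for B C
        using disj[OF that(1,2)] that(3) by auto
      show ?thesis
        using I[OF that(1)] I[OF that(2)] that(3)
        by (elim disjE exE conjE) (simp_all add: R_def * ** ***)
    qed
    then show ?thesis by (simp add: disjoint_family_on_def)
  qed
  \<comment> \<open>a block contained in the diagonal is \<open>B \<times> B\<close> with \<open>B\<close> a singleton\<close>
  moreover have "R i \<noteq> {}" if "i \<in> I" for i
  proof (cases i)
    case (Inr B)
    then show ?thesis using that ne by (auto simp: R_def I_def)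
  next
    case (Inl p)
    then obtain B C where BC: "i = Inl (B, C)" "B \<in> P" "C \<in> P" "(B, C) \<notin> D"
      using \<open>i \<in> I\<close> by (cases p) (auto simp: I_def)
    obtain x y where "x \<in> B" "y \<in> C" "x \<noteq> y"
    proof (cases "B = C")
      case True
      then have "\<not> is_singleton B" using BC by (auto simp: D_def)
      moreover obtain x where "x \<in> B" using ne BC by blast
      ultimately show ?thesis using that True is_singletonI'[of B] by blast
    next
      case False
      then have "B \<inter> C = {}" using disj BC by blast
      moreover obtain x y where "x \<in> B" "y \<in> C" using ne BC by blast
      ultimately show ?thesis using that by blast
    qed
    then show ?thesis using BC by (auto simp: R_def)
  qed
  ultimately have "mat.dim (mat.span ((\<lambda>i. ind_mat (R i)) ` I)) = card I"
    using finP by (intro dim_span_ind_mat_disjoint) (auto simp: I_def)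
  moreover have "mat.span ((\<lambda>i. ind_mat (R i)) ` I) = mat.span (block_mats P)"
  proof
    have "ind_mat (R i) \<in> mat.span (block_mats P)" if "i \<in> I" for i
      using that ind_mat_off_diag_in_span[OF _ _ P]
      by (auto simp: I_def R_def block_mats_def[of P] intro: mat.span_base)
    then show "mat.span ((\<lambda>i. ind_mat (R i)) ` I) \<subseteq> mat.span (block_mats P)"
      by (intro mat.span_minimal) auto
    have E: "ind_mat (Id_on B) \<in> mat.span ((\<lambda>i. ind_mat (R i)) ` I)" if "B \<in> P" for B
      using that by (intro mat.span_base image_eqI[of _ _ "Inr B"]) (auto simp: R_def I_def)
    have O: "ind_mat (B \<times> C - Id) \<in> mat.span ((\<lambda>i. ind_mat (R i)) ` I)" if "B \<in> P" "C \<in> P" for B C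
    proof (cases "(B, C) \<in> D")
      case True
      then have "ind_mat (B \<times> C - Id) = 0"
        by (auto simp: D_def is_singleton_def ind_mat_def fun_eq_iff)
      then show ?thesis by (simp add: mat.span_zero)
    next
      case False
      then show ?thesis
        using that by (intro mat.span_base image_eqI[of _ _ "Inl (B, C)"]) (auto simp: R_def I_def)
    qed
    have "ind_mat (B \<times> C) = ind_mat (B \<times> C - Id) + (if B = C then ind_mat (Id_on B) else 0)"
      if "B \<in> P" "C \<in> P" for B C
      using disj[OF that] by (auto simp: ind_mat_def fun_eq_iff)
    then show "mat.span (block_mats P) \<subseteq> mat.span ((\<lambda>i. ind_mat (R i)) ` I)"
      using E O by (intro mat.span_minimal)
        (auto simp: block_mats_def intro!: mat.span_add mat.span_zero)
  qed
  moreover have "card I + card {B \<in> P. is_singleton B} = card P ^ 2 + card P"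
  proof -
    have "card D = card {B \<in> P. is_singleton B}"
      unfolding D_def by (rule card_image) (auto simp: inj_on_def)
    moreover have "card (P \<times> P - D) = card (P \<times> P) - card D"
      using D finP by (intro card_Diff_subset) (auto intro: finite_subset)
    moreover have "card D \<le> card (P \<times> P)" using D finP by (intro card_mono) auto
    ultimately show ?thesis
      using finP by (simp add: I_def card_Plus card_cartesian_product power2_eq_square)
  qed
  ultimately show ?thesis by (simp add: mat_dim_def)
qed

section \<open>Terwilliger algebras spanned by blocks\<close>

context group
begin

lemma conjugacy_class_self:
  assumes "x \<in> carrier G" shows "x \<in> conjugacy_class G x"
  using assms unfolding conjugacy_class_def by (auto intro!: exI[of _ \<one>])

lemma conjugacy_class_subset:
  assumes "x \<in> carrier G" shows "conjugacy_class G x \<subseteq> carrier G"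
  using assms by (auto simp: conjugacy_class_def)

lemma conjugacy_class_mono:
  assumes x: "x \<in> carrier G" and y: "y \<in> conjugacy_class G x"
  shows "conjugacy_class G y \<subseteq> conjugacy_class G x"
proof
  fix z assume "z \<in> conjugacy_class G y"
  then obtain g h where gh: "g \<in> carrier G" "h \<in> carrier G"
      "y = g \<otimes> x \<otimes> inv g" "z = h \<otimes> y \<otimes> inv h"
    using y by (auto simp: conjugacy_class_def)
  then have "z = (h \<otimes> g) \<otimes> x \<otimes> inv (h \<otimes> g)"
    using x by (simp add: inv_mult_group m_assoc)
  then show "z \<in> conjugacy_class G x"
    using gh by (auto simp: conjugacy_class_def)
qed

lemma conjugacy_class_eq:
  assumes x: "x \<in> carrier G" and y: "y \<in> conjugacy_class G x"
  shows "conjugacy_class G y = conjugacy_class G x"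
proof -
  obtain g where g: "g \<in> carrier G" "y = g \<otimes> x \<otimes> inv g"
    using y by (auto simp: conjugacy_class_def)
  then have "x = inv g \<otimes> y \<otimes> inv (inv g)"
    using x by (simp add: m_assoc) (simp flip: m_assoc)
  then have "x \<in> conjugacy_class G y"
    using g unfolding conjugacy_class_def by blast
  moreover have "y \<in> carrier G" using g x by simp
  ultimately show ?thesis
    using conjugacy_class_mono x y by blast
qed

lemma conjugacy_class_one: "conjugacy_class G \<one> = {\<one>}"
proof -
  have "g \<otimes> \<one> \<otimes> inv g = \<one>" if "g \<in> carrier G" for g
    using that by simp
  then show ?thesis
    unfolding conjugacy_class_def by force
qed

lemma partition_conjugacy_classes: "partition_on (carrier G) (conjugacy_classes G)"
proof (rule partition_onI)
  show "\<Union> (conjugacy_classes G) = carrier G"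
    using conjugacy_class_self conjugacy_class_subset by (auto simp: conjugacy_classes_def)
next
  fix B C assume "B \<in> conjugacy_classes G" "C \<in> conjugacy_classes G" "B \<noteq> C"
  then show "disjnt B C"
    using conjugacy_class_eq unfolding conjugacy_classes_def disjnt_def by blast
next
  show "{} \<notin> conjugacy_classes G"
    using conjugacy_class_self by (auto simp: conjugacy_classes_def)
qed

lemma scheme_adjacency_ind_mat:
  "scheme_adjacency G C = ind_mat {(x, y). x \<in> carrier G \<and> y \<in> carrier G \<and> y \<otimes> inv x \<in> C}"
  by (auto simp: scheme_adjacency_def ind_mat_def fun_eq_iff)

lemma dual_idempotent_ind_mat:
  "C \<subseteq> carrier G \<Longrightarrow> dual_idempotent G C = ind_mat (Id_on C)"
  by (auto simp: dual_idempotent_def ind_mat_def fun_eq_iff)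

text \<open>The adjacency matrices add up to the all-ones matrix \<open>J\<close>, and multiplying \<open>J\<close> by dual
  idempotents on both sides cuts out any block.\<close>

lemma block_mats_subset_subalgebra:
  assumes fin: "finite (carrier G)" and T: "is_subalgebra (carrier G) T"
    and A: "scheme_adjacency G ` conjugacy_classes G \<subseteq> T"
    and E: "dual_idempotent G ` conjugacy_classes G \<subseteq> T"
  shows "block_mats (conjugacy_classes G) \<subseteq> T"
proof -
  let ?P = "conjugacy_classes G"
  note P = partition_conjugacy_classes
  have finP: "finite ?P" using finite_elements[OF fin P] .
  have sub: "B \<subseteq> carrier G" if "B \<in> ?P" for B using P that by (auto simp: partition_on_def)
  have E': "ind_mat (Id_on B) \<in> T" if "B \<in> ?P" for B
    using E that dual_idempotent_ind_mat[OF sub[OF that]] by auto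
  have "ind_mat (carrier G \<times> carrier G)
      = ind_mat (\<Union>C\<in>?P. {(x, y). x \<in> carrier G \<and> y \<in> carrier G \<and> y \<otimes> inv x \<in> C})"
    using P by (auto simp: ind_mat_inject partition_on_def)
  also have "\<dots> = (\<Sum>C\<in>?P. scheme_adjacency G C)"
    unfolding scheme_adjacency_ind_mat using finP P
    by (intro ind_mat_disjoint_UN) (fastforce simp: disjoint_family_on_def partition_on_def disjoint_def)+
  also have "\<dots> \<in> T"
    using T A by (intro mat.subspace_sum) (auto simp: is_subalgebra_def)
  finally have J: "ind_mat (carrier G \<times> carrier G) \<in> T" .
  have "ind_mat (B \<times> C) \<in> T" if "B \<in> ?P" "C \<in> ?P" for B C
  proof -
    \<comment> \<open>\<open>E\<^sub>B J E\<^sub>C\<close>\<close>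
    let ?M = "mat_mul (carrier G) (ind_mat (Id_on B))
      (mat_mul (carrier G) (ind_mat (carrier G \<times> carrier G)) (ind_mat (Id_on C)))"
    have "ind_mat (B \<times> C) x y = ?M x y" for x y
    proof -
      have *: "mat_mul (carrier G) (ind_mat (carrier G \<times> carrier G)) (ind_mat (Id_on C)) z y
          = (if z \<in> carrier G \<and> y \<in> C then 1 else 0)" for z
      proof -
        have "{w \<in> carrier G. (z, w) \<in> carrier G \<times> carrier G \<and> (w, y) \<in> Id_on C}
            = (if z \<in> carrier G \<and> y \<in> C then {y} else {})"
          using sub[OF that(2)] by auto
        then show ?thesis by (simp add: mat_mul_ind_mat[OF fin])
      qed
      have "?M x y = (\<Sum>z\<in>carrier G. if z = x then if x \<in> B \<and> y \<in> C then 1 else 0 else 0)"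
        unfolding mat_mul_def[of _ "ind_mat (Id_on B)"] *
        by (intro sum.cong) (auto simp: ind_mat_def)
      then show ?thesis
        using fin sub[OF that(1)] by (auto simp: ind_mat_def)
    qed
    then have "ind_mat (B \<times> C) = ?M" by (intro ext)
    then show ?thesis
      using J E' that T by (simp add: is_subalgebra_def)
  qed
  then show ?thesis using E' by (auto simp: block_mats_def)
qed

text \<open>The assumption \<open>const\<close> says that off the diagonal each adjacency matrix other than the identity
  is constant on blocks, and hence a sum of blocks with the diagonal removed. The diagonal has to be
  exempt, by \<open>x' \<noteq> y'\<close>: when \<open>B = B'\<close> the pairs \<open>(x, x)\<close> belong to the class \<open>{1}\<close>.\<close>

lemma terwilliger_algebra_eq_span_block_mats:
  assumes fin: "finite (carrier G)"
    and const: "\<And>B B' C x y x' y'. \<lbrakk>B \<in> conjugacy_classes G; B' \<in> conjugacy_classes G;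
        C \<in> conjugacy_classes G; C \<noteq> {\<one>}; x \<in> B; x' \<in> B; y \<in> B'; y' \<in> B';
        y \<otimes> inv x \<in> C; x' \<noteq> y'\<rbrakk> \<Longrightarrow> y' \<otimes> inv x' \<in> C"
  shows "terwilliger_algebra G = mat.span (block_mats (conjugacy_classes G))"
  unfolding terwilliger_algebra_def generated_subalgebra_def
proof (rule hull_unique)
  let ?P = "conjugacy_classes G"
  note P = partition_conjugacy_classes
  have finP: "finite ?P" using finite_elements[OF fin P] .
  have sub: "B \<subseteq> carrier G" if "B \<in> ?P" for B using P that by (auto simp: partition_on_def)
  show sa: "is_subalgebra (carrier G) (mat.span (block_mats ?P))"
    by (rule is_subalgebra_span_block_mats[OF fin P])
  show "mat.span (block_mats ?P) \<subseteq> T"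
    if "scheme_adjacency G ` ?P \<union> dual_idempotent G ` ?P \<subseteq> T" "is_subalgebra (carrier G) T" for T
    using that block_mats_subset_subalgebra[OF fin that(2)]
    by (intro mat.span_minimal) (auto simp: is_subalgebra_def)
  have "dual_idempotent G C \<in> mat.span (block_mats ?P)" if "C \<in> ?P" for C
    using that sub by (auto simp: dual_idempotent_ind_mat block_mats_def intro!: mat.span_base)
  moreover have "scheme_adjacency G C \<in> mat.span (block_mats ?P)" if C: "C \<in> ?P" for C
  proof (cases "C = {\<one>}")
    case True
    have "y \<otimes> inv x = \<one> \<longleftrightarrow> y = x" if "x \<in> carrier G" "y \<in> carrier G" for x y
      using that by (metis inv_closed inv_equality inv_inv r_inv)
    then have "scheme_adjacency G C = mat_one (carrier G)"
      using True by (auto simp: scheme_adjacency_def mat_one_def fun_eq_iff)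
    then show ?thesis using sa by (simp add: is_subalgebra_def)
  next
    case False
    then have one: "\<one> \<notin> C"
      using C conjugacy_class_eq[of _ \<one>] conjugacy_class_one
      by (auto simp: conjugacy_classes_def)
    \<comment> \<open>the blocks that meet the relation of \<open>C\<close>; by \<open>const\<close> they lie in it up to the diagonal\<close>
    define Q where "Q = {(B, B') \<in> ?P \<times> ?P. \<exists>x\<in>B. \<exists>y\<in>B'. y \<otimes> inv x \<in> C}"
    have "{(x, y). x \<in> carrier G \<and> y \<in> carrier G \<and> y \<otimes> inv x \<in> C}
        = (\<Union>p\<in>Q. (case p of (B, B') \<Rightarrow> B \<times> B' - Id))" (is "?L = ?R")
    proof (intro equalityI subsetI)
      fix p assume "p \<in> ?L"
      then obtain x y where xy: "p = (x, y)" "x \<in> carrier G" "y \<in> carrier G" "y \<otimes> inv x \<in> C"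
        by auto
      then have "x \<noteq> y" using one by auto
      moreover have "(conjugacy_class G x, conjugacy_class G y) \<in> Q"
        using xy conjugacy_class_self by (auto simp: Q_def conjugacy_classes_def)
      ultimately show "p \<in> ?R"
        using xy(1-3) conjugacy_class_self
        by (intro UN_I[of "(conjugacy_class G x, conjugacy_class G y)"]) simp_all
    next
      fix p assume "p \<in> ?R"
      then obtain B B' x y where xy: "p = (x, y)" "(B, B') \<in> Q" "x \<in> B" "y \<in> B'" "x \<noteq> y"
        by auto
      then obtain u v where "u \<in> B" "v \<in> B'" "v \<otimes> inv u \<in> C" "B \<in> ?P" "B' \<in> ?P"
        by (auto simp: Q_def)
      then show "p \<in> ?L"
        using const[OF _ _ C False, of B B' u x v y] xy sub by auto
    qed
    then have "scheme_adjacency G C = ind_mat ?R"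
      by (simp add: scheme_adjacency_ind_mat)
    also have "\<dots> = (\<Sum>p\<in>Q. ind_mat (case p of (B, B') \<Rightarrow> B \<times> B' - Id))"
    proof (rule ind_mat_disjoint_UN)
      have Q: "Q \<subseteq> ?P \<times> ?P" by (auto simp: Q_def)
      show "finite Q" using finP by (auto intro: finite_subset[OF Q])
      show "disjoint_family_on (\<lambda>(B, B'). B \<times> B' - Id) Q"
        using disjoint_blocks_off_diag[OF P] Q by (rule disjoint_family_on_mono[rotated])
    qed
    also have "\<dots> \<in> mat.span (block_mats ?P)"
      using ind_mat_off_diag_in_span[OF _ _ P]
      by (intro mat.span_sum) (auto simp: Q_def)
    finally show ?thesis .
  qed
  ultimately show "scheme_adjacency G ` ?P \<union> dual_idempotent G ` ?P \<subseteq> mat.span (block_mats ?P)"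
    by auto
qed

end

section \<open>Frobenius groups with an abelian complement acting transitively\<close>

text \<open>
  The equation \<open>card_N\<close> makes the free action of the complement on the nontrivial elements of the
  kernel transitive.
\<close>

locale frobenius_split = group G for G (structure) +
  fixes N H :: "'a set"
  assumes semidirect: "internal_semidirect_product G N H"
    and complement: "frobenius_complement G H"
    and comm: "\<And>h k. \<lbrakk>h \<in> H; k \<in> H\<rbrakk> \<Longrightarrow> h \<otimes> k = k \<otimes> h"
    and fin: "finite (carrier G)"
    and card_N: "card N = card H + 1"
begin

lemma normal_N: "N \<lhd> G" and subgroup_H: "subgroup H G" and Int_NH: "N \<inter> H = {\<one>}"
  using semidirect by (auto simp: internal_semidirect_product_def)

lemma subgroup_N: "subgroup N G"
  using normal_N by (rule normal_imp_subgroup)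

lemma N_carrier: "x \<in> N \<Longrightarrow> x \<in> carrier G" and H_carrier: "x \<in> H \<Longrightarrow> x \<in> carrier G"
  using subgroup.mem_carrier[OF subgroup_N] subgroup.mem_carrier[OF subgroup_H] by auto

lemma finite_N: "finite N" and finite_H: "finite H"
  using fin subgroup.subset[OF subgroup_N] subgroup.subset[OF subgroup_H]
  by (blast intro: finite_subset)+

lemma factorE:
  assumes "g \<in> carrier G"
  obtains a h where "a \<in> N" "h \<in> H" "g = a \<otimes> h"
  using semidirect assms unfolding internal_semidirect_product_def set_mult_def by blast

lemma conj_N: "g \<in> carrier G \<Longrightarrow> a \<in> N \<Longrightarrow> g \<otimes> a \<otimes> inv g \<in> N"
  using normal.inv_op_closed2[OF normal_N] .

text \<open>If \<open>a\<close> commutes with \<open>h\<close>, then \<open>h\<close> lies in the conjugate of \<open>H\<close> by \<open>a \<notin> H\<close>, which meets \<open>H\<close>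
  trivially.\<close>

lemma commute_kernel_complement:
  assumes a: "a \<in> N" "a \<noteq> \<one>" and h: "h \<in> H" and eq: "a \<otimes> h = h \<otimes> a"
  shows "h = \<one>"
proof -
  have car: "a \<in> carrier G" "h \<in> carrier G" using a h N_carrier H_carrier by auto
  have "h = a \<otimes> h \<otimes> inv a" using car by (simp add: eq m_assoc)
  then have "h \<in> conjugate_set G a H"
    using h by (auto simp: conjugate_set_def l_coset_def r_coset_def)
  moreover have "a \<notin> H" using a Int_NH by auto
  ultimately show ?thesis
    using complement h car unfolding frobenius_complement_def by blast
qed

lemma conj_eq_imp_commute:
  assumes "x \<in> carrier G" "y \<in> carrier G" "z \<in> carrier G"
    and "x \<otimes> z \<otimes> inv x = y \<otimes> z \<otimes> inv y"
  shows "(inv y \<otimes> x) \<otimes> z = z \<otimes> (inv y \<otimes> x)"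
proof -
  have "(inv y \<otimes> x) \<otimes> z = inv y \<otimes> (x \<otimes> z \<otimes> inv x) \<otimes> x"
    using assms(1-3) by (simp add: m_assoc)
  also have "\<dots> = inv y \<otimes> (y \<otimes> z \<otimes> inv y) \<otimes> x"
    by (simp add: assms(4))
  also have "\<dots> = z \<otimes> (inv y \<otimes> x)"
    using assms(1-3) by (simp add: m_assoc) (simp flip: m_assoc)
  finally show ?thesis .
qed

text \<open>Conjugation of \<open>x\<close> by distinct elements of \<open>H\<close> gives distinct elements of \<open>N - {\<one>}\<close>, and there
  are as many elements in \<open>H\<close> as in \<open>N - {\<one>}\<close>.\<close>

lemma conjugacy_class_in_kernel:
  assumes x: "x \<in> N - {\<one>}"
  shows "conjugacy_class G x = N - {\<one>}"
proof
  have car: "x \<in> carrier G" using x N_carrier by auto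
  show "conjugacy_class G x \<subseteq> N - {\<one>}"
  proof
    fix y assume y: "y \<in> conjugacy_class G x"
    then have "y \<in> N" using x conj_N by (auto simp: conjugacy_class_def)
    moreover have "y \<noteq> \<one>"
    proof
      assume "y = \<one>"
      then have "conjugacy_class G x = {\<one>}"
        using conjugacy_class_eq[OF car y] conjugacy_class_one by simp
      then show False using conjugacy_class_self[OF car] x by auto
    qed
    ultimately show "y \<in> N - {\<one>}" by simp
  qed
  let ?c = "\<lambda>h. h \<otimes> x \<otimes> inv h"
  have "inj_on ?c H"
  proof (rule inj_onI)
    fix h k assume hk: "h \<in> H" "k \<in> H" "?c h = ?c k"
    then have "inv k \<otimes> h \<in> H"
      using subgroup_H by (simp add: subgroup.m_closed subgroup.m_inv_closed)
    moreover have "x \<otimes> (inv k \<otimes> h) = (inv k \<otimes> h) \<otimes> x"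
      using conj_eq_imp_commute[of h k x] hk car H_carrier by simp
    ultimately have "inv k \<otimes> h = \<one>"
      using commute_kernel_complement[of x "inv k \<otimes> h"] x by auto
    then have "k = h" using hk H_carrier by (metis inv_closed inv_equality inv_inv)
    then show "h = k" ..
  qed
  then have "card (?c ` H) = card (N - {\<one>})"
    using card_N subgroup.one_closed[OF subgroup_N] by (simp add: card_image)
  moreover have c: "?c ` H \<subseteq> conjugacy_class G x"
    using H_carrier by (auto simp: conjugacy_class_def)
  ultimately have "?c ` H = N - {\<one>}"
    using \<open>conjugacy_class G x \<subseteq> N - {\<one>}\<close> finite_N by (intro card_subset_eq) auto
  then show "N - {\<one>} \<subseteq> conjugacy_class G x" using c by simp
qed

lemma coset_eq_complement:
  assumes "g \<in> carrier G"
  obtains h where "h \<in> H" "N #> g = N #> h"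
proof -
  obtain a h where "a \<in> N" "h \<in> H" "g = a \<otimes> h" using assms by (rule factorE)
  then have "N #> h = N #> g"
    using H_carrier subgroup_N by (intro repr_independence) (auto simp: r_coset_def)
  then show ?thesis using that \<open>h \<in> H\<close> by simp
qed

text \<open>The quotient by \<open>N\<close> is abelian because the elements of \<open>H\<close>, which commute,
  represent all its cosets.\<close>

lemma coset_commute:
  assumes g: "g \<in> carrier G" and x: "x \<in> carrier G"
  shows "N #> (g \<otimes> x) = N #> (x \<otimes> g)"
proof -
  obtain h where h: "h \<in> H" "N #> g = N #> h" using g by (rule coset_eq_complement)
  obtain k where k: "k \<in> H" "N #> x = N #> k" using x by (rule coset_eq_complement)
  have "N #> (g \<otimes> x) = N #> (h \<otimes> k)"
    using normal.rcos_sum[OF normal_N] g x h k H_carrier by metis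
  also have "\<dots> = N #> (k \<otimes> h)" using comm h k by simp
  also have "\<dots> = N #> (x \<otimes> g)"
    using normal.rcos_sum[OF normal_N] g x h k H_carrier by metis
  finally show ?thesis .
qed

lemma conjugacy_class_subset_coset:
  assumes x: "x \<in> carrier G"
  shows "conjugacy_class G x \<subseteq> N #> x"
proof
  fix y assume "y \<in> conjugacy_class G x"
  then obtain g where g: "g \<in> carrier G" "y = g \<otimes> x \<otimes> inv g"
    by (auto simp: conjugacy_class_def)
  have "g \<otimes> x \<in> N #> (x \<otimes> g)"
    using repr_independenceD[OF subgroup_N _ coset_commute[OF x g(1)]] g x by simp
  then obtain a where a: "a \<in> N" "g \<otimes> x = a \<otimes> (x \<otimes> g)"
    by (auto simp: r_coset_def)
  then have "y = a \<otimes> x"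
    using g x N_carrier by (simp add: m_assoc)
  then show "y \<in> N #> x" using a by (auto simp: r_coset_def)
qed

text \<open>The coset of \<open>x\<close> has a representative \<open>h \<in> H - {\<one>}\<close>. Conjugating \<open>h\<close> by distinct elements of \<open>N\<close>
  gives distinct elements of \<open>N #> h\<close>, enough to exhaust the coset.\<close>

lemma conjugacy_class_outside_kernel:
  assumes x: "x \<in> carrier G" "x \<notin> N"
  shows "conjugacy_class G x = N #> x"
proof -
  obtain h where h: "h \<in> H" "N #> x = N #> h" using x(1) by (rule coset_eq_complement)
  have hcar: "h \<in> carrier G" using h H_carrier by simp
  have h1: "h \<noteq> \<one>"
  proof
    assume "h = \<one>"
    then have "N #> x = N" using h subgroup.subset[OF subgroup_N] by (simp add: coset_mult_one)
    then show False using rcos_self[OF x(1) subgroup_N] x by simp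
  qed
  let ?c = "\<lambda>a. a \<otimes> h \<otimes> inv a"
  have "inj_on ?c N"
  proof (rule inj_onI)
    fix a b assume ab: "a \<in> N" "b \<in> N" "?c a = ?c b"
    then have "inv b \<otimes> a \<in> N"
      using subgroup_N by (simp add: subgroup.m_closed subgroup.m_inv_closed)
    moreover have "(inv b \<otimes> a) \<otimes> h = h \<otimes> (inv b \<otimes> a)"
      using conj_eq_imp_commute[of a b h] ab hcar N_carrier by simp
    ultimately have "inv b \<otimes> a = \<one>"
      using commute_kernel_complement[of "inv b \<otimes> a" h] h(1) h1 by auto
    then have "b = a" using ab N_carrier by (metis inv_closed inv_equality inv_inv)
    then show "a = b" ..
  qed
  then have "card (?c ` N) = card (N #> h)"
    using card_rcosets_equal[of "N #> h" N] rcosetsI[of N h] hcar subgroup.subset[OF subgroup_N]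
    by (simp add: card_image)
  moreover have c: "?c ` N \<subseteq> conjugacy_class G h"
    using N_carrier by (auto simp: conjugacy_class_def)
  moreover have sub: "conjugacy_class G h \<subseteq> N #> h"
    by (rule conjugacy_class_subset_coset[OF hcar])
  moreover have "finite (N #> h)"
    using finite_N by (auto simp: r_coset_def)
  ultimately have "?c ` N = N #> h" by (intro card_subset_eq) auto
  then have eq: "conjugacy_class G h = N #> x" using c sub h by auto
  then have "x \<in> conjugacy_class G h" using rcos_self[OF x(1) subgroup_N] by simp
  then show ?thesis using conjugacy_class_eq[OF hcar] eq by simp
qed

lemma conjugacy_classes_eq:
  "conjugacy_classes G = insert {\<one>} (insert (N - {\<one>}) ((\<lambda>h. N #> h) ` (H - {\<one>})))"
proof -
  have "H - {\<one>} \<noteq> {}"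
    using complement subgroup.one_closed[OF subgroup_H] by (auto simp: frobenius_complement_def)
  then have "card H > 0" using finite_H by (auto simp: card_gt_0_iff)
  then have "card (N - {\<one>}) \<noteq> 0"
    using card_N subgroup.one_closed[OF subgroup_N] by simp
  then obtain n where n: "n \<in> N - {\<one>}"
    by (metis card.empty ex_in_conv)
  show ?thesis
  proof (intro equalityI subsetI)
    fix C assume "C \<in> conjugacy_classes G"
    then obtain x where x: "x \<in> carrier G" "C = conjugacy_class G x"
      by (auto simp: conjugacy_classes_def)
    consider "x = \<one>" | "x \<in> N - {\<one>}" | "x \<notin> N" by blast
    then show "C \<in> insert {\<one>} (insert (N - {\<one>}) ((\<lambda>h. N #> h) ` (H - {\<one>})))"
    proof cases
      case 1 then show ?thesis using x conjugacy_class_one by simp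
    next
      case 2 then show ?thesis using x conjugacy_class_in_kernel by simp
    next
      case 3
      obtain h where h: "h \<in> H" "N #> x = N #> h" using x(1) by (rule coset_eq_complement)
      have "h \<noteq> \<one>"
        using h 3 x rcos_self[OF x(1) subgroup_N] subgroup.subset[OF subgroup_N]
        by (auto simp: coset_mult_one)
      then show ?thesis using h 3 x conjugacy_class_outside_kernel by auto
    qed
  next
    fix C assume C: "C \<in> insert {\<one>} (insert (N - {\<one>}) ((\<lambda>h. N #> h) ` (H - {\<one>})))"
    have "\<exists>x\<in>carrier G. C = conjugacy_class G x"
    proof -
      consider "C = {\<one>}" | "C = N - {\<one>}" | h where "h \<in> H - {\<one>}" "C = N #> h"
        using C by blast
      then show ?thesis
      proof cases
        case 1 then show ?thesis using conjugacy_class_one by (intro bexI[of _ \<one>]) auto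
      next
        case 2 then show ?thesis
          using n conjugacy_class_in_kernel N_carrier by (intro bexI[of _ n]) auto
      next
        case 3
        then have "h \<notin> N" using Int_NH by auto
        then show ?thesis
          using 3 conjugacy_class_outside_kernel H_carrier by (intro bexI[of _ h]) auto
      qed
    qed
    then show "C \<in> conjugacy_classes G" by (auto simp: conjugacy_classes_def)
  qed
qed

lemma card_H_ge_2: "card H \<ge> 2"
proof -
  obtain h where h: "h \<in> H" "h \<noteq> \<one>"
    using complement subgroup.one_closed[OF subgroup_H] by (auto simp: frobenius_complement_def)
  then have "card {\<one>, h} \<le> card H"
    using finite_H subgroup.one_closed[OF subgroup_H] by (intro card_mono) auto
  then show ?thesis using h by simp
qed

lemma card_conjugacy_classes: "card (conjugacy_classes G) = card N"
proof -
  have N1: "\<one> \<in> N" and H1: "\<one> \<in> H"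
    using subgroup.one_closed subgroup_N subgroup_H by auto
  have inj: "inj_on (\<lambda>h. N #> h) (H - {\<one>})"
  proof (rule inj_onI)
    fix h k assume hk: "h \<in> H - {\<one>}" "k \<in> H - {\<one>}" "N #> h = N #> k"
    then have "h \<in> N #> k"
      using rcos_self[of h N] subgroup_N H_carrier by auto
    then obtain a where a: "a \<in> N" "h = a \<otimes> k" by (auto simp: r_coset_def)
    then have "a = h \<otimes> inv k"
      using hk H_carrier N_carrier by (simp add: m_assoc)
    then have "a \<in> H"
      using hk subgroup_H by (simp add: subgroup.m_closed subgroup.m_inv_closed)
    then have "a = \<one>" using a Int_NH by auto
    then show "h = k" using a hk H_carrier by simp
  qed
  have off: "h \<in> N #> h" "h \<notin> N" if "h \<in> H - {\<one>}" for h
    using that rcos_self[of h N] subgroup_N H_carrier Int_NH by auto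
  have "card (N - {\<one>}) \<noteq> 0" using card_N card_H_ge_2 N1 by simp
  then have "{\<one>} \<notin> insert (N - {\<one>}) ((\<lambda>h. N #> h) ` (H - {\<one>}))"
    using off by auto
  moreover have "N - {\<one>} \<notin> (\<lambda>h. N #> h) ` (H - {\<one>})"
    using off by auto
  ultimately show ?thesis
    using card_image[OF inj] finite_H H1 card_N card_H_ge_2
    by (simp add: conjugacy_classes_eq)
qed

lemma singleton_conjugacy_classes: "{C \<in> conjugacy_classes G. is_singleton C} = {{\<one>}}"
proof -
  have "\<not> is_singleton (N - {\<one>})"
    using card_N card_H_ge_2 subgroup.one_closed[OF subgroup_N]
    by (simp add: is_singleton_altdef)
  moreover have "\<not> is_singleton (N #> h)" if "h \<in> H" for h
  proof -
    have "card (N #> h) = card N"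
      using card_rcosets_equal[of "N #> h" N] rcosetsI[of N h] that H_carrier
        subgroup.subset[OF subgroup_N] by simp
    then show ?thesis using card_N card_H_ge_2 by (simp add: is_singleton_altdef)
  qed
  ultimately show ?thesis
    unfolding conjugacy_classes_eq by (auto simp: is_singleton_def)
qed

text \<open>Replacing \<open>x\<close> and \<open>y\<close> by conjugates keeps their cosets of \<open>N\<close>, and so that of \<open>y \<otimes> inv x\<close>. A
  coset other than \<open>N\<close> is a class, and \<open>N\<close> contains only one class besides \<open>{\<one>}\<close>.\<close>

lemma quotient_class_depends_on_classes:
  assumes C: "C \<in> conjugacy_classes G" "C \<noteq> {\<one>}"
    and B: "B \<in> conjugacy_classes G" "x \<in> B" "x' \<in> B"
    and B': "B' \<in> conjugacy_classes G" "y \<in> B'" "y' \<in> B'"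
    and yx: "y \<otimes> inv x \<in> C" and ne: "x' \<noteq> y'"
  shows "y' \<otimes> inv x' \<in> C"
proof -
  have class_eq: "z \<in> carrier G \<and> D = conjugacy_class G z" if "D \<in> conjugacy_classes G" "z \<in> D" for D z
  proof -
    obtain u where u: "u \<in> carrier G" "D = conjugacy_class G u"
      using \<open>D \<in> conjugacy_classes G\<close> by (auto simp: conjugacy_classes_def)
    then show ?thesis
      using conjugacy_class_subset[OF u(1)] conjugacy_class_eq[OF u(1)] \<open>z \<in> D\<close> by auto
  qed
  have car: "x \<in> carrier G" "y \<in> carrier G" "x' \<in> carrier G" "y' \<in> carrier G"
    using class_eq[OF B(1,2)] class_eq[OF B'(1,2)] class_eq[OF B(1,3)] class_eq[OF B'(1,3)] by simp_all
  define c where "c = y \<otimes> inv x"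
  have c: "c \<in> carrier G" "C = conjugacy_class G c"
    using class_eq[OF C(1) yx] by (simp_all add: c_def)
  have "x' \<in> N #> x" "y' \<in> N #> y"
    using class_eq[OF B(1,2)] class_eq[OF B'(1,2)] conjugacy_class_subset_coset B(3) B'(3) by auto
  then obtain a b where ab: "a \<in> N" "x' = a \<otimes> x" "b \<in> N" "y' = b \<otimes> y"
    by (auto simp: r_coset_def)
  have "y' \<otimes> inv x' = b \<otimes> c \<otimes> inv a"
    using ab car N_carrier by (simp add: c_def inv_mult_group m_assoc)
  then have "y' \<otimes> inv x' = b \<otimes> (c \<otimes> inv a \<otimes> inv c) \<otimes> c"
    using ab c(1) N_carrier by (simp add: m_assoc)
  moreover have "b \<otimes> (c \<otimes> inv a \<otimes> inv c) \<in> N"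
    using ab c conj_N subgroup_N by (simp add: subgroup.m_closed subgroup.m_inv_closed)
  ultimately have mem: "y' \<otimes> inv x' \<in> N #> c"
    by (auto simp: r_coset_def)
  show ?thesis
  proof (cases "c \<in> N")
    case False
    then show ?thesis using mem c conjugacy_class_outside_kernel by simp
  next
    case True
    have "c \<noteq> \<one>" using C c conjugacy_class_one by auto
    then have "C = N - {\<one>}" using True c conjugacy_class_in_kernel by simp
    moreover have "N #> c = N" using True c subgroup_N by (simp add: coset_join2)
    moreover have "y' \<otimes> inv x' \<noteq> \<one>"
      using ne car by (metis inv_closed inv_equality inv_inv)
    ultimately show ?thesis using mem by simp
  qed
qed

lemma dim_terwilliger_algebra:
  "mat_dim (terwilliger_algebra G) = card N ^ 2 + card N - 1"
proof -
  have "terwilliger_algebra G = mat.span (block_mats (conjugacy_classes G))"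
    using quotient_class_depends_on_classes
    by (intro terwilliger_algebra_eq_span_block_mats[OF fin]) blast
  then show ?thesis
    using dim_span_block_mats[OF fin partition_conjugacy_classes]
    by (simp add: card_conjugacy_classes singleton_conjugacy_classes)
qed

end

lemma card_integer_mod_group: "m > 0 \<Longrightarrow> card (carrier (integer_mod_group m)) = m"
  by (simp add: carrier_integer_mod_group)

lemma card_cyclic_power_group:
  "m > 0 \<Longrightarrow> card (carrier (cyclic_power_group m n)) = m ^ n"
  by (simp add: cyclic_power_group_def card_PiE card_integer_mod_group)

theorem theorem5p2:
  fixes G :: "('a, 'b) monoid_scheme" and N H :: "'a set" and p n :: nat
  assumes "Factorial_Ring.prime p" and "n \<ge> 1"
    and "group G" and "finite (carrier G)"
    and "internal_semidirect_product G N H"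
    and "frobenius_complement G H" and "N = frobenius_kernel G H"
    and "G\<lparr>carrier := N\<rparr> \<cong> cyclic_power_group p n"
    and "G\<lparr>carrier := H\<rparr> \<cong> integer_mod_group (p ^ n - 1)"
  shows "mat_dim (terwilliger_algebra G) = p ^ (2 * n) + p ^ n - 1"
proof -
  interpret group G by fact
  have p: "p > 1" using assms(1) by (rule prime_gt_1_nat)
  then have q: "p ^ n > 1" using assms(2) by (intro one_less_power) auto
  have cN: "card N = p ^ n"
    using iso_same_card[OF assms(8)] card_cyclic_power_group[of p n] p by simp
  have cH: "card H = p ^ n - 1"
    using iso_same_card[OF assms(9)] card_integer_mod_group[of "p ^ n - 1"] q by simp
  have H: "subgroup H G" using assms(6) by (simp add: frobenius_complement_def)
  have gH: "group (G\<lparr>carrier := H\<rparr>)"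
    using subgroup.subgroup_is_group[OF H is_group] .
  have "comm_group (G\<lparr>carrier := H\<rparr>)"
    using comm_group.iso_imp_comm_group[OF abelian_integer_mod_group group.iso_sym[OF gH assms(9)]]
      gH by (simp add: group.is_monoid)
  then have "h \<otimes>\<^bsub>G\<^esub> k = k \<otimes>\<^bsub>G\<^esub> h" if "h \<in> H" "k \<in> H" for h k
    using comm_monoid.m_comm[of "G\<lparr>carrier := H\<rparr>" h k] that by (simp add: comm_group_def)
  then interpret frobenius_split G N H
    using assms(4-6) cN cH q by unfold_locales auto
  show ?thesis
    using dim_terwilliger_algebra by (simp add: cN power_mult mult.commute power_even_eq)
qed

end
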